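(* For every positive integer $t$, let $K_t(2)$ be the cocktail party graph on $2t$ vertices. Then $$t\,\delta(t)\le \mathrm{scc}(K_t(2))\le t\,\sigma(t),$$ where $\sigma(t)=\min\{k : t\le \binom{k-1}{\lceil k/2\rceil}\}$ and $\delta(t)=\min\{k-1 : t\le \binom{k}{\lceil k/2\rceil}\}$.
   Context: The cocktail party graph $K_t(2)$ is obtained from the complete graph on vertex set $\{x_1,\dots,x_t\}\cup\{y_1,\dots,y_t\}$ by deleting the $t$ edges $x_iy_i$, $1\le i\le t$. A clique of a graph $G$ is a set of pairwise adjacent vertices; a clique covering of $G$ is a family of cliques such that every edge of $G$ lies in at least one of them. $\mathrm{scc}(G)$ is the minimum of $\sum_{C\in\mathcal{C}}|C|$ over all clique coverings $\mathcal{C}$ of $G$. *)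

theory Defs
  imports Complex_Main "HOL-Library.Ramsey"
begin

text \<open>
  A simple graph is given by its vertex set \<open>V\<close> and its set \<open>E\<close> of two-element edges.
\<close>

definition clique_covering :: "'a set \<Rightarrow> 'a set set \<Rightarrow> 'a set set \<Rightarrow> bool" where
  "clique_covering V E \<C> \<longleftrightarrow>
     (\<forall>C\<in>\<C>. C \<subseteq> V \<and> clique C E) \<and> (\<forall>e\<in>E. \<exists>C\<in>\<C>. e \<subseteq> C)"

text \<open>
  Meant for finite \<open>V\<close>, where all cliques and all coverings are finite.  A repeated member
  only increases the sum, so sets of cliques suffice for the minimum over families.
\<close>

definition scc :: "'a set \<Rightarrow> 'a set set \<Rightarrow> nat" where
  "scc V E = Inf {\<Sum>C\<in>\<C>. card C |\<C>. clique_covering V E \<C>}"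

text \<open>The vertices \<open>x\<^sub>i\<close> and \<open>y\<^sub>i\<close> are \<open>Inl i\<close> and \<open>Inr i\<close>.\<close>

definition cocktail_verts :: "nat \<Rightarrow> (nat + nat) set" where
  "cocktail_verts t = Inl ` {1..t} \<union> Inr ` {1..t}"

definition cocktail_edges :: "nat \<Rightarrow> (nat + nat) set set" where
  "cocktail_edges t = [cocktail_verts t]\<^bsup>2\<^esup> - {{Inl i, Inr i} |i. i \<in> {1..t}}"

text \<open>
  Both minima range over positive \<open>k\<close>.  Without this, truncated subtraction would make
  \<open>k = 0\<close> admissible for \<open>\<sigma>\<close> at \<open>t = 1\<close>, via \<open>(0 - 1) choose 0 = 1\<close>.
\<close>

definition sigma :: "nat \<Rightarrow> nat" where
  "sigma t = Inf {k. k \<ge> 1 \<and> t \<le> (k - 1) choose nat \<lceil>real k / 2\<rceil>}"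

definition delta :: "nat \<Rightarrow> nat" where
  "delta t = Inf {k - 1 |k. k \<ge> 1 \<and> t \<le> k choose nat \<lceil>real k / 2\<rceil>}"

text \<open>The infima above are attained, so they are minima.\<close>

lemma scc_attained:
  assumes "E \<subseteq> [V]\<^bsup>2\<^esup>"
  shows "\<exists>\<C>. clique_covering V E \<C> \<and> scc V E = (\<Sum>C\<in>\<C>. card C)"
proof -
  have "clique e E" if e: "e \<in> E" for e
  proof -
    from e assms obtain x y where "e = {x, y}"
      unfolding nsets_2_eq by blast
    with e show ?thesis by (auto simp: clique_def insert_commute)
  qed
  then have "clique_covering V E E"
    using assms by (auto simp: clique_covering_def nsets_def)
  then have "{\<Sum>C\<in>\<C>. card C |\<C>. clique_covering V E \<C>} \<noteq> {}"
    by blast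
  from Inf_nat_def1[OF this] show ?thesis
    by (auto simp: scc_def)
qed

lemma cocktail_edges_subset: "cocktail_edges t \<subseteq> [cocktail_verts t]\<^bsup>2\<^esup>"
  by (auto simp: cocktail_edges_def)

lemma le_central_choose:
  assumes "t \<ge> 1"
  shows "t \<le> (2 * t - 1) choose t"
  using assms
proof (induction t rule: dec_induct)
  case base
  then show ?case by simp
next
  case (step m)
  have "(2 * m) choose m = ((2 * m - 1) choose m) + ((2 * m - 1) choose (m - 1))"
    using step.hyps by (subst choose_reduce_nat) auto
  moreover have "(2 * m) choose (m + 1) \<ge> 1"
    using step.hyps by (simp add: Suc_leI)
  moreover have "(2 * Suc m - 1) choose Suc m = ((2 * m) choose m) + ((2 * m) choose (m + 1))"
    by simp
  ultimately show ?case using step.IH by linarith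
qed

lemma sigma_attained:
  assumes "t \<ge> 1"
  shows "sigma t \<ge> 1" and "t \<le> (sigma t - 1) choose nat \<lceil>real (sigma t) / 2\<rceil>"
proof -
  have "2 * t \<in> {k. k \<ge> 1 \<and> t \<le> (k - 1) choose nat \<lceil>real k / 2\<rceil>}"
    using assms le_central_choose[OF assms] by simp
  then have "sigma t \<in> {k. k \<ge> 1 \<and> t \<le> (k - 1) choose nat \<lceil>real k / 2\<rceil>}"
    unfolding sigma_def by (intro Inf_nat_def1) blast
  then show "sigma t \<ge> 1" and "t \<le> (sigma t - 1) choose nat \<lceil>real (sigma t) / 2\<rceil>"
    by auto
qed

lemma delta_attained:
  assumes "t \<ge> 1"
  shows "\<exists>k\<ge>1. delta t = k - 1 \<and> t \<le> k choose nat \<lceil>real k / 2\<rceil>"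
proof -
  have "(2 * t - 1) choose t \<le> (2 * t) choose t"
    by (intro binomial_right_mono) auto
  then have "2 * t - 1 \<in> {k - 1 |k. k \<ge> 1 \<and> t \<le> k choose nat \<lceil>real k / 2\<rceil>}"
    using assms le_central_choose[OF assms] by (auto intro!: exI[of _ "2 * t"])
  then have "delta t \<in> {k - 1 |k. k \<ge> 1 \<and> t \<le> k choose nat \<lceil>real k / 2\<rceil>}"
    unfolding delta_def by (intro Inf_nat_def1) blast
  then show ?thesis by auto
qed

end

theory Submission
  imports Defs
begin

text \<open>
  Lower bound: given a clique covering, let \<open>A\<^sub>i\<close> and \<open>B\<^sub>i\<close> be the sets of cliques containing
  \<open>x\<^sub>i\<close> and \<open>y\<^sub>i\<close>. They are disjoint, while \<open>A\<^sub>i\<close> meets \<open>B\<^sub>j\<close> for \<open>i \<noteq> j\<close>, so Bollobas' set-pair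
  inequality bounds the sum of \<open>1 / f s\<^sub>i\<close> by 1, where \<open>s\<^sub>i = |A\<^sub>i| + |B\<^sub>i|\<close> and \<open>f\<close> is the
  central binomial coefficient. Since \<open>1 / f\<close> is convex on the positive integers and
  \<open>f (\<delta>(t)) < t\<close>, its supporting line at \<open>\<delta>(t)\<close> forces the \<open>s\<^sub>i\<close> to be at least \<open>\<delta>(t)\<close> on
  average, and the sum of the \<open>s\<^sub>i\<close> is the size of the covering.

  Upper bound: choose \<open>t\<close> distinct \<open>\<lceil>k/2\<rceil>\<close>-subsets of a \<open>(k-1)\<close>-set, where \<open>k = \<sigma>(t)\<close>. They form
  an intersecting antichain, and no two of them cover a \<open>k\<close>-set containing that ground set. Using
  them and their complements in the \<open>k\<close>-set as the incidence vectors of the \<open>x\<^sub>i\<close> and \<open>y\<^sub>i\<close> yields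
  \<open>k\<close> cliques of size \<open>t\<close>.
\<close>

section \<open>Bollobas' set-pair inequality\<close>

text \<open>An absorption identity: in the averaging step below it evaluates the total contribution
  of the \<open>b\<close> points of \<open>B i\<close>, each of which lowers
  \<open>card (B i)\<close> by one.\<close>

lemma binomial_pred_div:
  assumes "b > 0"
  shows "real b / real ((a + (b - 1)) choose a) = real (a + b) / real ((a + b) choose a)"
proof -
  obtain c where b: "b = Suc c" using assms by (cases b) auto
  have "Suc c * (Suc (a + c) choose Suc c) = Suc (a + c) * ((a + c) choose c)"
    by (rule Suc_times_binomial)
  moreover have "(a + c) choose c = (a + c) choose a"
    by (metis add_diff_cancel_right' binomial_symmetric le_add2)
  moreover have "Suc (a + c) choose Suc c = Suc (a + c) choose a"
    using binomial_symmetric[of a "Suc (a + c)"] by simp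
  ultimately have "real (Suc c) * real (Suc (a + c) choose a)
      = real (Suc (a + c)) * real ((a + c) choose a)"
    by (metis of_nat_mult)
  then show ?thesis by (simp add: b field_simps)
qed

text \<open>Induction on \<open>card X\<close>, deleting one point \<open>x\<close>: pairs with
  \<open>x\<close> in \<open>A i\<close> are dropped and \<open>x\<close> is removed from the other
  \<open>B i\<close>. The remaining \<open>A i\<close> avoid \<open>x\<close>, so crossing
  intersections survive. Since \<open>A\<close> never changes, only \<open>X\<close>,
  \<open>I\<close> and \<open>B\<close> are generalized.\<close>

theorem set_pair_inequality:
  fixes A B :: "'i \<Rightarrow> 'a set"
  assumes "finite X" and "finite I"
    and "\<And>i. i \<in> I \<Longrightarrow> A i \<subseteq> X" and "\<And>i. i \<in> I \<Longrightarrow> B i \<subseteq> X"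
    and "\<And>i. i \<in> I \<Longrightarrow> A i \<inter> B i = {}"
    and "\<And>i j. i \<in> I \<Longrightarrow> j \<in> I \<Longrightarrow> i \<noteq> j \<Longrightarrow> A i \<inter> B j \<noteq> {}"
  shows "(\<Sum>i\<in>I. 1 / real ((card (A i) + card (B i)) choose card (A i))) \<le> 1"
  using assms
proof (induction "card X" arbitrary: X I B rule: less_induct)
  case less
  note fX = less.prems(1) and fI = less.prems(2) and AX = less.prems(3) and BX = less.prems(4)
    and disj = less.prems(5) and cross = less.prems(6)
  let ?w = "\<lambda>i. 1 / real ((card (A i) + card (B i)) choose card (A i))"
  show ?case
  proof (cases "\<exists>i\<in>I. B i = {}")
    case True
    then obtain i where i: "i \<in> I" "B i = {}" by blast
    \<comment> \<open>Any other \<open>A j\<close> would have to meet the empty \<open>B i\<close>;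
      the single pair has weight 1.\<close>
    then have "I = {i}" using cross by blast
    then show ?thesis using i by simp
  next
    case False
    show ?thesis
    proof (cases "I = {}")
      case True
      then show ?thesis by simp
    next
      case nonempty: False
      then have "X \<noteq> {}" using False BX by blast
      then have cX: "card X > 0" using fX by (simp add: card_gt_0_iff)
      define u where "u x i = (if x \<in> A i then 0 else
        1 / real ((card (A i) + card (B i - {x})) choose card (A i)))" for x i
      \<comment> \<open>Average over the deletion of a point \<open>x\<close>, keeping the pairs with \<open>x \<notin> A i\<close>.\<close>
      have del: "(\<Sum>i\<in>I. u x i) \<le> 1" if x: "x \<in> X" for x
      proof -
        let ?J = "{i \<in> I. x \<notin> A i}"
        have "(\<Sum>i\<in>?J. 1 / real ((card (A i) + card (B i - {x})) choose card (A i))) \<le> 1"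
        proof (rule less.hyps[of "X - {x}"])
          show "card (X - {x}) < card X" using x fX by (meson card_Diff1_less)
          show "A i \<inter> (B j - {x}) \<noteq> {}" if "i \<in> ?J" "j \<in> ?J" "i \<noteq> j" for i j
            using that cross[of i j] by auto
          show "A i \<subseteq> X - {x}" if "i \<in> ?J" for i using that AX[of i] by auto
          show "B i - {x} \<subseteq> X - {x}" if "i \<in> ?J" for i using that BX[of i] by auto
          show "A i \<inter> (B i - {x}) = {}" if "i \<in> ?J" for i using that disj[of i] by auto
        qed (use fX fI in auto)
        also have "(\<Sum>i\<in>?J. 1 / real ((card (A i) + card (B i - {x})) choose card (A i)))
            = (\<Sum>i\<in>I. u x i)"
          unfolding u_def by (rule sum.mono_neutral_cong_left) (use fI in auto)
        finally show ?thesis .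
      qed
      have avg: "(\<Sum>x\<in>X. u x i) = real (card X) * ?w i" if i: "i \<in> I" for i
      proof -
        let ?a = "card (A i)" and ?b = "card (B i)"
        let ?R = "X - A i - B i"
        have fin: "finite (A i)" "finite (B i)"
          using AX[OF i] BX[OF i] fX finite_subset by blast+
        have b: "?b > 0" using False i fin by (simp add: card_gt_0_iff)
        have X: "X = A i \<union> (B i \<union> ?R)" using AX[OF i] BX[OF i] by blast
        have dj: "A i \<inter> (B i \<union> ?R) = {}" "B i \<inter> ?R = {}" using disj[OF i] by auto
        have fR: "finite ?R" using fX by blast
        \<comment> \<open>Points of \<open>A i\<close> contribute 0, those of \<open>B i\<close>
          together \<open>?a + ?b\<close> times the weight \<open>?w i\<close>, and every other
          point \<open>?w i\<close> itself.\<close>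
        have "(\<Sum>x\<in>X. u x i) = (\<Sum>x\<in>A i. u x i) + (\<Sum>x\<in>B i \<union> ?R. u x i)"
          using sum.union_disjoint[of "A i" "B i \<union> ?R"] dj(1) fin fR X by (metis finite_Un)
        also have "(\<Sum>x\<in>B i \<union> ?R. u x i) = (\<Sum>x\<in>B i. u x i) + (\<Sum>x\<in>?R. u x i)"
          using fin(2) fR dj(2) by (rule sum.union_disjoint)
        also have "(\<Sum>x\<in>A i. u x i) = 0" by (simp add: u_def)
        also have "(\<Sum>x\<in>B i. u x i) = (\<Sum>x\<in>B i. 1 / real ((?a + (?b - 1)) choose ?a))"
          by (rule sum.cong) (use disj[OF i] fin in \<open>auto simp: u_def\<close>)
        also have "\<dots> = real ?b / real ((?a + (?b - 1)) choose ?a)" by simp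
        also have "\<dots> = real (?a + ?b) * ?w i" using binomial_pred_div[OF b] by simp
        also have "(\<Sum>x\<in>?R. u x i) = (\<Sum>x\<in>?R. ?w i)"
          by (rule sum.cong) (auto simp: u_def)
        also have "\<dots> = real (card ?R) * ?w i" by simp
        also have "0 + (real (?a + ?b) * ?w i + real (card ?R) * ?w i)
            = real (?a + ?b + card ?R) * ?w i"
          by (simp add: algebra_simps add_divide_distrib)
        also have "?a + ?b + card ?R = card X"
          using card_Un_disjoint[of "A i" "B i \<union> ?R"] card_Un_disjoint[of "B i" ?R] dj fin fR X
          by (metis add.assoc finite_Un)
        finally show ?thesis .
      qed
      have "real (card X) * (\<Sum>i\<in>I. ?w i) = (\<Sum>i\<in>I. \<Sum>x\<in>X. u x i)"
        by (simp add: sum_distrib_left avg)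
      also have "\<dots> = (\<Sum>x\<in>X. \<Sum>i\<in>I. u x i)" by (rule sum.swap)
      also have "\<dots> \<le> (\<Sum>x\<in>X. 1)" by (rule sum_mono) (rule del)
      also have "\<dots> = real (card X) * 1" by simp
      finally show ?thesis using cX by (simp only: mult_le_cancel_left_pos of_nat_0_less_iff)
    qed
  qed
qed

section \<open>Convexity of the reciprocal central binomial coefficient\<close>

text \<open>Rounding down here and up in \<open>delta\<close> gives the same coefficient, by
  symmetry (\<open>choose_ceiling_half\<close>).\<close>

definition inv_central :: "nat \<Rightarrow> real" where
  "inv_central n = 1 / real (n choose (n div 2))"

lemma inv_central_pos: "inv_central n > 0"
  by (simp add: inv_central_def)

lemma inv_central_odd: "inv_central (2 * m + 1) = inv_central (2 * m) * (m + 1) / (2 * m + 1)"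
proof -
  have "Suc m * (Suc (2 * m) choose Suc m) = Suc (2 * m) * ((2 * m) choose m)"
    by (rule Suc_times_binomial)
  moreover have "Suc (2 * m) choose Suc m = Suc (2 * m) choose m"
    using binomial_symmetric[of m "Suc (2 * m)"] by simp
  ultimately have *: "real (m + 1) * real (Suc (2 * m) choose m)
      = real (2 * m + 1) * real ((2 * m) choose m)"
    by (metis of_nat_mult Suc_eq_plus1)
  have "1 / x = 1 / y * a / b" if "x > 0" "y > 0" "b > 0" "a * x = b * y"
    for x y a b :: real
    using that by (simp add: field_simps)
  from this[OF _ _ _ *] show ?thesis by (simp add: inv_central_def)
qed

lemma inv_central_even: "inv_central (2 * m + 2) = inv_central (2 * m + 1) / 2"
proof -
  have "Suc (2 * m) choose Suc m = Suc (2 * m) choose m"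
    using binomial_symmetric[of m "Suc (2 * m)"] by simp
  then have "Suc (Suc (2 * m)) choose Suc m = 2 * (Suc (2 * m) choose m)"
    by (metis binomial_Suc_Suc mult_2)
  then show ?thesis by (simp add: inv_central_def)
qed

text \<open>At \<open>n = 0\<close> this fails: the first values are \<open>1, 1, 1/2\<close>.\<close>

lemma inv_central_convex:
  assumes "n \<ge> 1"
  shows "2 * inv_central (Suc n) \<le> inv_central n + inv_central (Suc (Suc n))"
proof (cases "even n")
  case True
  then obtain m where n: "n = 2 * m" by blast
  with assms have m: "m \<ge> 1" by simp
  let ?r = "real (m + 1) / real (2 * m + 1)"
  \<comment> \<open>With successive ratios \<open>?r\<close> and \<open>1/2\<close>, convexity reads
    \<open>2 * ?r \<le> 1 + ?r / 2\<close>, which holds exactly when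
    \<open>m \<ge> 1\<close>.\<close>
  have "3 * ?r \<le> 2" using m by (simp add: field_simps)
  then have "inv_central n * (3 * ?r) \<le> inv_central n * 2"
    using inv_central_pos[of n] by (intro mult_left_mono) auto
  then have "3 * (inv_central n * ?r) \<le> 2 * inv_central n"
    by (simp only: mult.left_commute mult.commute)
  moreover have "inv_central (Suc n) = inv_central n * ?r"
    using inv_central_odd[of m] by (simp add: n)
  moreover have "inv_central (Suc (Suc n)) = inv_central (Suc n) / 2"
    using inv_central_even[of m] by (simp add: n)
  ultimately show ?thesis by linarith
next
  case False
  then obtain m where n: "n = 2 * m + 1" by (elim oddE)
  \<comment> \<open>The first value is twice the second, so positivity of the third
    suffices.\<close>
  then show ?thesis
    using inv_central_even[of m] inv_central_pos[of "Suc (Suc n)"] by simp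
qed

lemma inv_central_Suc_less:
  assumes "n \<ge> 1"
  shows "inv_central (Suc n) < inv_central n"
proof (cases "even n")
  case True
  then obtain m where n: "n = 2 * m" by blast
  with assms have "real (m + 1) / real (2 * m + 1) < 1" by (simp add: field_simps)
  then have "inv_central n * (real (m + 1) / real (2 * m + 1)) < inv_central n * 1"
    using inv_central_pos[of n] by (intro mult_strict_left_mono) auto
  then show ?thesis using inv_central_odd[of m] by (simp add: n)
next
  case False
  then obtain m where n: "n = 2 * m + 1" by (elim oddE)
  then show ?thesis using inv_central_even[of m] inv_central_pos[of n] by simp
qed

text \<open>The line passes through the values at \<open>d\<close> and \<open>Suc d\<close>. By
  convexity the drops between consecutive values never grow, so induction away from \<open>d\<close>
  in either direction keeps the function above the line.\<close>

lemma inv_central_supporting_line: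
  assumes "d \<ge> 1" and "s \<ge> 1"
  shows "inv_central d - (inv_central d - inv_central (Suc d)) * (real s - real d) \<le> inv_central s"
proof -
  define slope where "slope n = inv_central n - inv_central (Suc n)" for n
  have anti: "slope n \<le> slope m" if "1 \<le> m" "m \<le> n" for m n
    using that(2,1)
  proof (induction n rule: dec_induct)
    case (step n)
    then show ?case using inv_central_convex[of n] by (simp add: slope_def)
  qed simp
  have "inv_central d - slope d * (real s - real d) \<le> inv_central s"
  proof (cases "d \<le> s")
    case True
    then show ?thesis
    proof (induction s rule: dec_induct)
      case (step s)
      have "slope s \<le> slope d" using anti assms step by simp
      then show ?case using step.IH by (simp add: slope_def algebra_simps)
    qed simp
  next
    case False
    then have "s \<le> d" by simp
    then show ?thesis using assms(2)
    proof (induction s rule: inc_induct)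
      case (step s)
      have "slope d \<le> slope s" using anti step by simp
      then show ?case using step by (simp add: slope_def algebra_simps)
    qed simp
  qed
  then show ?thesis by (simp add: slope_def)
qed

text \<open>Sum the supporting lines at \<open>d\<close>: the constant terms exceed 1 in total, so
  the linear terms must bring the sum down, which forces the mean of the \<open>s i\<close> above
  \<open>d\<close>.\<close>

lemma sum_gt_if_inv_central_le_1:
  fixes s :: "'i \<Rightarrow> nat"
  assumes "d \<ge> 1" and pos: "\<And>i. i \<in> I \<Longrightarrow> s i \<ge> 1"
    and le: "(\<Sum>i\<in>I. inv_central (s i)) \<le> 1"
    and large: "d choose (d div 2) < card I"
  shows "card I * d < (\<Sum>i\<in>I. s i)"
proof -
  define c where "c = inv_central d - inv_central (Suc d)"
  have c: "c > 0" using inv_central_Suc_less assms(1) by (simp add: c_def)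
  have "1 < real (card I) * inv_central d"
    using large by (simp add: inv_central_def field_simps)
  moreover have "real (card I) * inv_central d - c * ((\<Sum>i\<in>I. real (s i)) - card I * real d)
      = (\<Sum>i\<in>I. inv_central d - c * (real (s i) - real d))"
    by (simp add: sum_subtractf sum_distrib_left right_diff_distrib)
  moreover have "\<dots> \<le> (\<Sum>i\<in>I. inv_central (s i))"
    unfolding c_def using inv_central_supporting_line[OF assms(1)] pos by (intro sum_mono) blast
  ultimately have "0 < c * ((\<Sum>i\<in>I. real (s i)) - card I * real d)"
    using le by linarith
  then have "real (card I * d) < real (\<Sum>i\<in>I. s i)"
    using c by (simp add: zero_less_mult_iff)
  then show ?thesis by (simp only: of_nat_less_iff)
qed

section \<open>Clique coverings of the cocktail party graph\<close>

lemma nat_ceiling_half: "nat \<lceil>real k / 2\<rceil> = (k + 1) div 2"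
proof -
  have "real k \<le> 2 * real ((k + 1) div 2)" "2 * real ((k + 1) div 2) \<le> real k + 1"
    by linarith+
  then have "\<lceil>real k / 2\<rceil> = int ((k + 1) div 2)"
    by (intro ceiling_unique) simp_all
  then show ?thesis by simp
qed

lemma choose_ceiling_half: "k choose nat \<lceil>real k / 2\<rceil> = k choose (k div 2)"
proof -
  have "k - k div 2 = (k + 1) div 2" by linarith
  then show ?thesis
    using binomial_symmetric[of "k div 2" k] by (simp add: nat_ceiling_half)
qed

lemma finite_cocktail_verts: "finite (cocktail_verts t)"
  by (simp add: cocktail_verts_def)

lemma sum_cocktail_verts:
  "(\<Sum>v\<in>cocktail_verts t. f v) = (\<Sum>i\<in>{1..t}. f (Inl i) + f (Inr i))"
  unfolding cocktail_verts_def
  by (subst sum.union_disjoint) (auto simp: sum.reindex sum.distrib)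

lemma cocktail_edge_iff:
  "{u, v} \<in> cocktail_edges t \<longleftrightarrow> u \<in> cocktail_verts t \<and> v \<in> cocktail_verts t \<and> u \<noteq> v
     \<and> (\<forall>i. u = Inl i \<longrightarrow> v \<noteq> Inr i) \<and> (\<forall>i. u = Inr i \<longrightarrow> v \<noteq> Inl i)"
  unfolding cocktail_edges_def cocktail_verts_def
  by (auto simp: nsets_def doubleton_eq_iff card_insert_if)

section \<open>Lower bound for an arbitrary covering\<close>

lemma delta_le_covering:
  assumes cov: "clique_covering (cocktail_verts t) (cocktail_edges t) \<C>"
  shows "t * delta t \<le> (\<Sum>C\<in>\<C>. card C)"
proof (cases "delta t = 0")
  case False
  \<comment> \<open>\<open>delta t\<close> is one less than the least admissible \<open>k\<close>;
    were it admissible itself, \<open>delta t - 1\<close> would be a smaller candidate.\<close>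
  have small: "delta t choose (delta t div 2) < t"
  proof (rule ccontr)
    assume "\<not> ?thesis"
    then have "delta t - 1 \<in> {k - 1 |k. k \<ge> 1 \<and> t \<le> k choose nat \<lceil>real k / 2\<rceil>}"
      using False by (auto simp: choose_ceiling_half intro!: exI[of _ "delta t"])
    then have "delta t \<le> delta t - 1"
      unfolding delta_def by (rule wellorder_Inf_le1)
    then show False using False by simp
  qed
  have CV: "C \<subseteq> cocktail_verts t" and clq: "clique C (cocktail_edges t)" if "C \<in> \<C>" for C
    using cov that by (auto simp: clique_covering_def)
  have fin: "finite \<C>"
    using CV finite_cocktail_verts by (intro finite_subset[of \<C> "Pow (cocktail_verts t)"]) auto
  define \<D> where "\<D> v = {C \<in> \<C>. v \<in> C}" for v
  have finD: "finite (\<D> v)" for v using fin by (simp add: \<D>_def)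
  have meet: "\<D> u \<inter> \<D> v \<noteq> {}" if "{u, v} \<in> cocktail_edges t" for u v
    using cov that by (fastforce simp: clique_covering_def \<D>_def)
  have cross: "\<D> (Inl i) \<inter> \<D> (Inr j) \<noteq> {}" if "i \<in> {1..t}" "j \<in> {1..t}" "i \<noteq> j" for i j
    using that by (intro meet) (auto simp: cocktail_edge_iff cocktail_verts_def)
  have disj: "\<D> (Inl i) \<inter> \<D> (Inr i) = {}" for i
  proof -
    have False if "C \<in> \<C>" "Inl i \<in> C" "Inr i \<in> C" for C
    proof -
      have "{Inl i, Inr i} \<in> cocktail_edges t"
        using clq[OF that(1)] that(2,3) by (simp add: clique_def)
      then show False by (simp add: cocktail_edge_iff)
    qed
    then show ?thesis by (auto simp: \<D>_def)
  qed
  define s where "s i = card (\<D> (Inl i)) + card (\<D> (Inr i))" for i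
  \<comment> \<open>A second index provides each \<open>Inl i\<close> with an edge, hence with a
    clique containing it; the supporting line is available only for
    \<open>s i \<ge> 1\<close>.\<close>
  have "t \<ge> 2"
    using small zero_less_binomial[of "delta t div 2" "delta t"] by linarith
  have pos: "s i \<ge> 1" if i: "i \<in> {1..t}" for i
  proof -
    obtain j where "j \<in> {1..t}" "j \<noteq> i"
      using \<open>t \<ge> 2\<close> i by (cases "i = 1") (auto intro: that[of 1] that[of 2])
    then have "\<D> (Inl i) \<noteq> {}" using cross[OF i] by blast
    then have "card (\<D> (Inl i)) > 0" using finD by (simp add: card_gt_0_iff)
    then show ?thesis by (simp add: s_def)
  qed
  \<comment> \<open>The central coefficient is the largest in its row, so its reciprocal is the
    smallest.\<close>
  have "(\<Sum>i\<in>{1..t}. inv_central (s i)) \<le>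
      (\<Sum>i\<in>{1..t}. 1 / real ((card (\<D> (Inl i)) + card (\<D> (Inr i))) choose card (\<D> (Inl i))))"
    unfolding inv_central_def s_def
    by (intro sum_mono divide_left_mono) (auto intro!: binomial_maximum)
  also have "\<dots> \<le> 1"
    by (rule set_pair_inequality[of \<C>]) (use fin disj cross in \<open>auto simp: \<D>_def\<close>)
  finally have "card {1..t} * delta t < (\<Sum>i\<in>{1..t}. s i)"
    using False small pos by (intro sum_gt_if_inv_central_le_1) auto
  also have "(\<Sum>i\<in>{1..t}. s i) = (\<Sum>v\<in>cocktail_verts t. card (\<D> v))"
    by (simp add: s_def sum_cocktail_verts)
  \<comment> \<open>Double counting of incidences between vertices and cliques.\<close>
  also have "\<dots> = (\<Sum>C\<in>\<C>. card C)"
    unfolding \<D>_def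
    by (rule sum_multicount_gen)
      (use fin finite_cocktail_verts CV in \<open>auto intro!: arg_cong[of _ _ card]\<close>)
  finally show ?thesis by simp
qed simp

section \<open>Upper bound by cliques read off from a set family\<close>

lemma ex_covering_of_intersecting_antichain:
  fixes A :: "nat \<Rightarrow> 'a set"
  assumes "finite K"
    and sub: "\<And>i. i \<in> {1..t} \<Longrightarrow> A i \<subseteq> K"
    and meet: "\<And>i j. i \<in> {1..t} \<Longrightarrow> j \<in> {1..t} \<Longrightarrow> i \<noteq> j \<Longrightarrow> A i \<inter> A j \<noteq> {}"
    and diff: "\<And>i j. i \<in> {1..t} \<Longrightarrow> j \<in> {1..t} \<Longrightarrow> i \<noteq> j \<Longrightarrow> A i - A j \<noteq> {}"
    and union: "\<And>i j. i \<in> {1..t} \<Longrightarrow> j \<in> {1..t} \<Longrightarrow> A i \<union> A j \<noteq> K"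
  shows "\<exists>\<C>. clique_covering (cocktail_verts t) (cocktail_edges t) \<C>
    \<and> (\<Sum>C\<in>\<C>. card C) \<le> t * card K"
proof -
  \<comment> \<open>For \<open>a\<close> in \<open>K\<close>, this is a column of the incidence
    matrix with rows \<open>A i\<close> for \<open>Inl i\<close> and \<open>K - A i\<close> for
    \<open>Inr i\<close>. It picks one end of each deleted edge, hence is a clique of size
    \<open>t\<close>.\<close>
  define Q where "Q a = Inl ` {i \<in> {1..t}. a \<in> A i} \<union> Inr ` {i \<in> {1..t}. a \<notin> A i}" for a
  have cardQ: "card (Q a) = t" for a
  proof -
    have "card (Q a) = card {i \<in> {1..t}. a \<in> A i} + card {i \<in> {1..t}. a \<notin> A i}"
      unfolding Q_def by (subst card_Un_disjoint) (auto simp: card_image)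
    also have "\<dots> = card ({i \<in> {1..t}. a \<in> A i} \<union> {i \<in> {1..t}. a \<notin> A i})"
      by (rule card_Un_disjoint[symmetric]) auto
    also have "{i \<in> {1..t}. a \<in> A i} \<union> {i \<in> {1..t}. a \<notin> A i} = {1..t}" by blast
    finally show ?thesis by simp
  qed
  have QV: "Q a \<subseteq> cocktail_verts t" for a by (auto simp: Q_def cocktail_verts_def)
  have "clique (Q a) (cocktail_edges t)" for a
    using QV[of a] unfolding clique_def cocktail_edge_iff by (auto simp: Q_def)
  moreover have "\<exists>a\<in>K. e \<subseteq> Q a" if e: "e \<in> cocktail_edges t" for e
  proof -
    from e obtain u v where uv: "e = {u, v}"
      using cocktail_edges_subset unfolding nsets_2_eq by blast
    note edge = e[unfolded uv cocktail_edge_iff cocktail_verts_def]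
    \<comment> \<open>Edges between two \<open>Inl\<close> vertices come from \<open>meet\<close>,
      mixed edges from \<open>diff\<close>, edges between two \<open>Inr\<close> vertices from
      \<open>union\<close>.\<close>
    show ?thesis
    proof (cases u; cases v)
      fix i j assume *: "u = Inl i" "v = Inl j"
      then have ij: "i \<in> {1..t}" "j \<in> {1..t}" "i \<noteq> j" using edge by auto
      then obtain a where "a \<in> A i" "a \<in> A j" using meet by blast
      then show ?thesis using * ij sub[OF ij(1)] uv by (auto simp: Q_def)
    next
      fix i j assume *: "u = Inl i" "v = Inr j"
      then have ij: "i \<in> {1..t}" "j \<in> {1..t}" "i \<noteq> j" using edge by auto
      then obtain a where "a \<in> A i" "a \<notin> A j" using diff by blast
      then show ?thesis using * ij sub[OF ij(1)] uv by (auto simp: Q_def)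
    next
      fix i j assume *: "u = Inr i" "v = Inl j"
      then have ij: "i \<in> {1..t}" "j \<in> {1..t}" "i \<noteq> j" using edge by auto
      then obtain a where "a \<in> A j" "a \<notin> A i" using diff[of j i] by blast
      then show ?thesis using * ij sub[OF ij(2)] uv by (auto simp: Q_def)
    next
      fix i j assume *: "u = Inr i" "v = Inr j"
      then have ij: "i \<in> {1..t}" "j \<in> {1..t}" using edge by auto
      then obtain a where "a \<in> K" "a \<notin> A i" "a \<notin> A j" using union[of i j] sub by blast
      then show ?thesis using * ij uv by (auto simp: Q_def)
    qed
  qed
  ultimately have "clique_covering (cocktail_verts t) (cocktail_edges t) (Q ` K)"
    using QV by (auto simp: clique_covering_def)
  moreover have "(\<Sum>C\<in>Q ` K. card C) \<le> t * card K"
  proof -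
    have "(\<Sum>C\<in>Q ` K. card C) = (\<Sum>C\<in>Q ` K. t)" by (rule sum.cong) (auto simp: cardQ)
    \<comment> \<open>Different points of \<open>K\<close> may give the same clique, hence only an
      inequality.\<close>
    also have "\<dots> \<le> t * card K" using card_image_le[OF assms(1), of Q] by simp
    finally show ?thesis .
  qed
  ultimately show ?thesis by blast
qed

lemma ex_covering_le_sigma:
  assumes "t \<ge> 1"
  shows "\<exists>\<C>. clique_covering (cocktail_verts t) (cocktail_edges t) \<C>
    \<and> (\<Sum>C\<in>\<C>. card C) \<le> t * sigma t"
proof -
  let ?k = "sigma t"
  define r where "r = (?k + 1) div 2"
  note k = sigma_attained[OF assms, unfolded nat_ceiling_half, folded r_def]
  define F where "F = {S. S \<subseteq> {..<?k - 1} \<and> card S = r}"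
  have "finite F" by (rule finite_subset[of _ "Pow {..<?k - 1}"]) (auto simp: F_def)
  moreover have "card {1..t} \<le> card F"
    using k(2) by (simp add: F_def n_subsets)
  ultimately obtain A where A: "A ` {1..t} \<subseteq> F" "inj_on A {1..t}"
    using card_le_inj[of "{1..t}" F] by auto
  have sub: "A i \<subseteq> {..<?k - 1}" and card: "card (A i) = r" if "i \<in> {1..t}" for i
    using subsetD[OF A(1) imageI[OF that]] by (simp_all add: F_def)
  have fin: "finite (A i)" if "i \<in> {1..t}" for i
    using sub[OF that] finite_subset by blast
  have "\<exists>\<C>. clique_covering (cocktail_verts t) (cocktail_edges t) \<C>
    \<and> (\<Sum>C\<in>\<C>. card C) \<le> t * card {..<?k}"
  proof (rule ex_covering_of_intersecting_antichain[of _ _ A])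
    show "A i \<subseteq> {..<?k}" if "i \<in> {1..t}" for i
      using sub[OF that] by auto
  next
    fix i j assume ij: "i \<in> {1..t}" "j \<in> {1..t}" "i \<noteq> j"
    show "A i \<inter> A j \<noteq> {}"
    proof
      assume "A i \<inter> A j = {}"
      \<comment> \<open>Two disjoint \<open>r\<close>-sets need \<open>2 * r \<ge> ?k\<close>
        points, one more than the ground set has.\<close>
      then have "r + r = card (A i \<union> A j)"
        using ij fin card by (simp add: card_Un_disjoint)
      also have "\<dots> \<le> card {..<?k - 1}"
        using sub[OF ij(1)] sub[OF ij(2)] by (intro card_mono) auto
      finally show False using k(1) by (simp add: r_def)
    qed
    show "A i - A j \<noteq> {}"
    proof
      assume "A i - A j = {}"
      then have "A i = A j" using ij fin card by (intro card_subset_eq) auto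
      then show False using A(2) ij by (auto dest: inj_onD)
    qed
  next
    fix i j assume ij: "i \<in> {1..t}" "j \<in> {1..t}"
    have "A i \<union> A j \<subseteq> {..<?k - 1}" using sub[OF ij(1)] sub[OF ij(2)] by (rule Un_least)
    \<comment> \<open>The extra point \<open>?k - 1\<close> lies in no \<open>A i\<close>; its
      clique consists of all \<open>Inr\<close> vertices.\<close>
    also have "\<dots> \<subset> {..<?k}" using k(1) by (simp add: lessThan_strict_subset_iff)
    finally show "A i \<union> A j \<noteq> {..<?k}" by (rule less_imp_neq)
  qed simp
  then show ?thesis by simp
qed

theorem theorem5:
  fixes t :: nat
  assumes "t \<ge> 1"
  shows "t * delta t \<le> scc (cocktail_verts t) (cocktail_edges t)
    \<and> scc (cocktail_verts t) (cocktail_edges t) \<le> t * sigma t"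
proof
  show "t * delta t \<le> scc (cocktail_verts t) (cocktail_edges t)"
  proof -
    obtain \<C> where "clique_covering (cocktail_verts t) (cocktail_edges t) \<C>"
      and "scc (cocktail_verts t) (cocktail_edges t) = (\<Sum>C\<in>\<C>. card C)"
      using scc_attained[OF cocktail_edges_subset] by blast
    then show ?thesis using delta_le_covering by simp
  qed
  obtain \<C> where \<C>: "clique_covering (cocktail_verts t) (cocktail_edges t) \<C>"
    and le: "(\<Sum>C\<in>\<C>. card C) \<le> t * sigma t"
    using ex_covering_le_sigma[OF assms] by blast
  have "scc (cocktail_verts t) (cocktail_edges t) \<le> (\<Sum>C\<in>\<C>. card C)"
    unfolding scc_def using \<C> by (intro wellorder_Inf_le1) blast
  then show "scc (cocktail_verts t) (cocktail_edges t) \<le> t * sigma t"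
    using le by linarith
qed

end
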